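(* Let $\mathcal J=\{J_1,\dots,J_m\}$ be a cover of $I=\{1,\dots,n\}$ such that: (i) each $J\in\mathcal J$ is an interval $\{s,\dots,u\}$ with $1\le s\le u\le n$, and for $1\le j<k\le m$, $\min(J_j)<\min(J_k)$ and $\max(J_j)<\max(J_k)$; (ii) for $1\le j<k\le m$ with $k-j\ge2$, $\max(J_j)<\min(J_k)-1$. For every $J\in\mathcal J$ let $W^J$ be a Wasserstein matrix for the ideal Gibbs kernel $P^J$ such that $$W^J_{i,j}=\begin{cases}\mathbb I_{[i=j]}, & i\in J^c,\\ 0, & i\in J,\ j\in I\setminus\partial J,\end{cases}\qquad W^J_{i,j}\in[0,1]\ \text{ for } i\in J,\ j\in\partial J .$$ Let $\partial=\bigcup_{J\in\mathcal J}\partial J$ and assume that there is a constant $\lambda<1$ such that $\max_{i\in J\cap\partial}\sum_{j\in\partial J}W^J_{i,j}\le\lambda$ for all $J\in\mathcal J$. Then, for any $k\ge1$: (1) For the ideal Parallel (PAR) sampler $\mathcal P=\mathcal P_{\rm odd}\mathcal P_{\rm even}$, with Wasserstein matrix $\mathcal W=\mathcal W_{\rm even}\mathcal W_{\rm odd}$, $$\|\mathcal W^k\|_\infty\le\|\mathcal W\|_\infty\,\lambda^{2(k-1)}\qquad\text{and}\qquad\|\mathcal W\|_\infty\le2 .$$ (2) For the ideal Left-to-Right sampler $\mathcal P=P^{J_1}\cdots P^{J_m}$, with Wasserstein matrix $\mathcal W=W^{J_m}\cdots W^{J_1}$, $$\|\mathcal W^k\|_\infty\le\|\mathcal W\|_\infty\,\beta^{k-1}\qquad\text{and}\qquad\|\mathcal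 W\|_\infty\le1+\lambda,$$ where $\beta=\max_{k\in\{2,\dots,m\}}(\lambda a_k+b_k)$, $a_k=W^{J_k}_{\partial_+J_{k-1},\,\partial_-J_k}$ and $b_k=W^{J_k}_{\partial_+J_{k-1},\,\partial_+J_k}$.
   Context: Setting: $\mathsf X$ is the state space and $\mathsf Y$ the observation space of a hidden Markov model with initial distribution having density $\mu_0$, transition kernel with density $m(x,x')$ with respect to a $\sigma$-finite measure on $\mathsf X$, and observation density $g(x,y)$. Observations $y_{1:n}$ are fixed. The joint smoothing distribution $\phi$ is the probability distribution on $\mathsf X^n$ with density proportional to $\mu_0(x_1)g(x_1,y_1)\prod_{t=2}^n m(x_{t-1},x_t)g(x_t,y_t)$. Notation: $I=\{1,\dots,n\}$. For $J\subset I$: $J^c=I\setminus J$, $x_J=(x_i:i\in J)$, and $\partial J=\{t\in J^c: t+1\in J\text{ or }t-1\in J\}$. For an interval $J=\{s,\dots,u\}$, $\partial_-J=s-1$ (if $s>1$) and $\partial_+J=u+1$ (if $u<n$) are its left and right boundary points; by convention $W^{J_1}_{i,\partial_-J_1}=W^{J_m}_{i,\partial_+J_m}=0$. $\phi^J_x$ is (a version of) the regular conditional distribution under $\phi$ of $X_J$ given $X_{J^c}=x_{J^c}$; it depends on $x$ only through $x_{\partial J}$. The ideal Gibbs kernel updating block $J$ is $P^J(x,\mathrm dx')=\phi^J_x(\mathrm dx'_J)\,\delta_{x_{J^c}}(\mathrm dx'_{J^c})$ on $\mathsf X^n$. Kernels are composed as $(PQ)(x,\cdot)=\int P(x,\mathrm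 dy)Q(y,\cdot)$. PAR: $\mathcal P_{\rm odd}=P^{J_1}P^{J_3}\cdots$ is the product (in increasing order) of $P^{J_k}$ over odd $k\le m$, and $\mathcal P_{\rm even}=P^{J_2}P^{J_4}\cdots$ is the product over even $k\le m$. $\mathcal W_{\rm odd}=\cdots W^{J_3}W^{J_1}$ and $\mathcal W_{\rm even}=\cdots W^{J_4}W^{J_2}$ are the corresponding products of matrices in reversed order. For $f:\mathsf X^n\to\mathbb R$, $\mathrm{osc}_i(f)=\sup\{|f(x)-f(y)|: x,y\in\mathsf X^n,\ x_j=y_j\ \forall j\ne i\}$, and $f$ has finite oscillation if $\sup_{x,z}|f(x)-f(z)|<\infty$. A (nonnegative) matrix $W=(W_{i,j})_{i,j\in I}$ is a Wasserstein matrix for a Markov kernel $P$ on $\mathsf X^n$ if $\mathrm{osc}_j(Pf)\le\sum_{i\in I}\mathrm{osc}_i(f)W_{i,j}$ for all $j\in I$ and all $f$ of finite oscillation. If $V,W$ are Wasserstein matrices for $P,Q$ respectively, then $WV$ is one for $PQ$. $\|A\|_\infty=\max_i\sum_j|a_{i,j}|$. A maximum over an empty index set is taken to be $0$. *)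

theory Defs
  imports "HOL-Probability.Probability" "Jordan_Normal_Form.Matrix"
begin

definition max0 :: "real set \<Rightarrow> real" where
  "max0 S = (if S = {} then 0 else Max S)"

text \<open>
  Coordinates are numbered \<open>1, \<dots>, n\<close>, whereas the entries of a matrix of type
  \<^typ>\<open>real mat\<close> are numbered from \<open>0\<close>. Entries at an index outside \<open>{1..n}\<close> are \<open>0\<close>;
  this yields the convention for the non-existent boundary points \<open>0\<close> and \<open>n + 1\<close>.
\<close>
definition entry :: "real mat \<Rightarrow> nat \<Rightarrow> nat \<Rightarrow> real" where
  "entry A i j =
     (if i \<in> {1..dim_row A} \<and> j \<in> {1..dim_col A} then A $$ (i - 1, j - 1) else 0)"

definition mat_norm_inf :: "real mat \<Rightarrow> real" where
  "mat_norm_inf A =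
     max0 ((\<lambda>i. \<Sum>j\<in>{1..dim_col A}. \<bar>entry A i j\<bar>) ` {1..dim_row A})"

definition mat_prod :: "nat \<Rightarrow> real mat list \<Rightarrow> real mat" where
  "mat_prod n As = foldr (*) As (1\<^sub>m n)"

definition osc :: "(nat \<Rightarrow> 'a) set \<Rightarrow> nat \<Rightarrow> ((nat \<Rightarrow> 'a) \<Rightarrow> real) \<Rightarrow> real" where
  "osc S i f = Sup {\<bar>f x - f z\<bar> | x z. x \<in> S \<and> z \<in> S \<and> (\<forall>j. j \<noteq> i \<longrightarrow> x j = z j)}"

definition finite_oscillation :: "(nat \<Rightarrow> 'a) set \<Rightarrow> ((nat \<Rightarrow> 'a) \<Rightarrow> real) \<Rightarrow> bool" where
  "finite_oscillation S f \<longleftrightarrow> bdd_above {\<bar>f x - f z\<bar> | x z. x \<in> S \<and> z \<in> S}"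

abbreviation path_space :: "'a measure \<Rightarrow> nat \<Rightarrow> (nat \<Rightarrow> 'a) measure" where
  "path_space M n \<equiv> PiM {1..n} (\<lambda>_. M)"

text \<open>The composition \<open>P\<^sub>1 P\<^sub>2 \<cdots>\<close>; the empty composition is the identity kernel on \<open>S\<close>.\<close>
definition kernel_prod :: "'s measure \<Rightarrow> ('s \<Rightarrow> 's measure) list \<Rightarrow> 's \<Rightarrow> 's measure" where
  "kernel_prod S Ps = foldr (\<lambda>P Q x. P x \<bind> Q) Ps (return S)"

definition wasserstein_matrix ::
  "'a measure \<Rightarrow> nat \<Rightarrow> ((nat \<Rightarrow> 'a) \<Rightarrow> (nat \<Rightarrow> 'a) measure) \<Rightarrow> real mat \<Rightarrow> bool" where
  "wasserstein_matrix M n P W \<longleftrightarrow>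
     W \<in> carrier_mat n n \<and>
     (\<forall>i\<in>{1..n}. \<forall>j\<in>{1..n}. 0 \<le> entry W i j) \<and>
     (\<forall>f \<in> borel_measurable (path_space M n).
        finite_oscillation (space (path_space M n)) f \<longrightarrow>
        (\<forall>j\<in>{1..n}.
           osc (space (path_space M n)) j (\<lambda>x. \<integral>x'. f x' \<partial>P x)
             \<le> (\<Sum>i\<in>{1..n}. osc (space (path_space M n)) i f * entry W i j)))"

definition hidden_markov_model ::
  "'a measure \<Rightarrow> 'b measure \<Rightarrow> ('a \<Rightarrow> real) \<Rightarrow> ('a \<Rightarrow> 'a \<Rightarrow> real) \<Rightarrow> ('a \<Rightarrow> 'b \<Rightarrow> real) \<Rightarrow> bool" where
  "hidden_markov_model M N \<mu>0 p g \<longleftrightarrow>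
     sigma_finite_measure M \<and>
     \<mu>0 \<in> borel_measurable M \<and> (\<forall>x\<in>space M. 0 \<le> \<mu>0 x) \<and>
     (\<integral>\<^sup>+x. ennreal (\<mu>0 x) \<partial>M) = 1 \<and>
     (\<lambda>(x, x'). p x x') \<in> borel_measurable (M \<Otimes>\<^sub>M M) \<and>
     (\<forall>x\<in>space M. \<forall>x'\<in>space M. 0 \<le> p x x') \<and>
     (\<forall>x\<in>space M. (\<integral>\<^sup>+x'. ennreal (p x x') \<partial>M) = 1) \<and>
     (\<lambda>(x, v). g x v) \<in> borel_measurable (M \<Otimes>\<^sub>M N) \<and>
     (\<forall>x\<in>space M. \<forall>v\<in>space N. 0 \<le> g x v) \<and>
     (\<forall>x\<in>space M. (\<integral>\<^sup>+v. ennreal (g x v) \<partial>N) = 1)"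

definition smoothing_weight ::
  "('a \<Rightarrow> real) \<Rightarrow> ('a \<Rightarrow> 'a \<Rightarrow> real) \<Rightarrow> ('a \<Rightarrow> 'b \<Rightarrow> real) \<Rightarrow> (nat \<Rightarrow> 'b) \<Rightarrow> nat
     \<Rightarrow> (nat \<Rightarrow> 'a) \<Rightarrow> real" where
  "smoothing_weight \<mu>0 p g y n x =
     \<mu>0 (x 1) * g (x 1) (y 1) * (\<Prod>t\<in>{2..n}. p (x (t - 1)) (x t) * g (x t) (y t))"

definition smoothing_const ::
  "'a measure \<Rightarrow> ('a \<Rightarrow> real) \<Rightarrow> ('a \<Rightarrow> 'a \<Rightarrow> real) \<Rightarrow> ('a \<Rightarrow> 'b \<Rightarrow> real) \<Rightarrow> (nat \<Rightarrow> 'b) \<Rightarrow> nat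
     \<Rightarrow> ennreal" where
  "smoothing_const M \<mu>0 p g y n =
     (\<integral>\<^sup>+x. ennreal (smoothing_weight \<mu>0 p g y n x) \<partial>path_space M n)"

text \<open>A probability measure only if the normalizing constant lies in \<open>(0, \<infinity>)\<close>.\<close>
definition smoothing_distribution ::
  "'a measure \<Rightarrow> ('a \<Rightarrow> real) \<Rightarrow> ('a \<Rightarrow> 'a \<Rightarrow> real) \<Rightarrow> ('a \<Rightarrow> 'b \<Rightarrow> real) \<Rightarrow> (nat \<Rightarrow> 'b) \<Rightarrow> nat
     \<Rightarrow> (nat \<Rightarrow> 'a) measure" where
  "smoothing_distribution M \<mu>0 p g y n =
     density (path_space M n)
       (\<lambda>x. ennreal (smoothing_weight \<mu>0 p g y n x) / smoothing_const M \<mu>0 p g y n)"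

definition boundary :: "nat \<Rightarrow> nat set \<Rightarrow> nat set" where
  "boundary n J = {t \<in> {1..n} - J. t + 1 \<in> J \<or> (\<exists>s\<in>J. t = s + 1)}"

definition left_boundary :: "nat set \<Rightarrow> nat" where
  "left_boundary J = Min J - 1"

definition right_boundary :: "nat set \<Rightarrow> nat" where
  "right_boundary J = Max J + 1"

text \<open>
  \<open>K\<close> is a version of the regular conditional distribution under \<open>\<phi>\<close> of \<open>X\<^sub>J\<close> given the
  remaining coordinates, and this version depends on them only through the boundary of \<open>J\<close>.
\<close>
definition block_conditional ::
  "'a measure \<Rightarrow> nat \<Rightarrow> (nat \<Rightarrow> 'a) measure \<Rightarrow> nat set
     \<Rightarrow> ((nat \<Rightarrow> 'a) \<Rightarrow> (nat \<Rightarrow> 'a) measure) \<Rightarrow> bool" where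
  "block_conditional M n \<phi> J K \<longleftrightarrow>
     K \<in> measurable (PiM ({1..n} - J) (\<lambda>_. M)) (prob_algebra (PiM J (\<lambda>_. M))) \<and>
     (\<forall>A \<in> sets (PiM J (\<lambda>_. M)). \<forall>B \<in> sets (PiM ({1..n} - J) (\<lambda>_. M)).
        emeasure \<phi> {x \<in> space \<phi>. restrict x J \<in> A \<and> restrict x ({1..n} - J) \<in> B} =
        (\<integral>\<^sup>+x. emeasure (K (restrict x ({1..n} - J))) A
                 * indicator B (restrict x ({1..n} - J)) \<partial>\<phi>)) \<and>
     (\<forall>x \<in> space (PiM ({1..n} - J) (\<lambda>_. M)). \<forall>z \<in> space (PiM ({1..n} - J) (\<lambda>_. M)).
        (\<forall>t \<in> boundary n J. x t = z t) \<longrightarrow> K x = K z)"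

definition gibbs_kernel ::
  "'a measure \<Rightarrow> nat \<Rightarrow> nat set \<Rightarrow> ((nat \<Rightarrow> 'a) \<Rightarrow> (nat \<Rightarrow> 'a) measure)
     \<Rightarrow> (nat \<Rightarrow> 'a) \<Rightarrow> (nat \<Rightarrow> 'a) measure" where
  "gibbs_kernel M n J K x =
     distr (K (restrict x ({1..n} - J))) (path_space M n) (\<lambda>z. merge J ({1..n} - J) (z, x))"

text \<open>
  The blocks are \<open>J 1, \<dots>, J m\<close>; the conditional distributions \<open>K\<close> and the Wasserstein
  matrices \<open>W\<close> are indexed by the blocks themselves. Matrices are multiplied in the order
  opposite to the kernels.
\<close>
definition update_kernel ::
  "'a measure \<Rightarrow> nat \<Rightarrow> (nat \<Rightarrow> nat set)
     \<Rightarrow> (nat set \<Rightarrow> (nat \<Rightarrow> 'a) \<Rightarrow> (nat \<Rightarrow> 'a) measure)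
     \<Rightarrow> nat list \<Rightarrow> (nat \<Rightarrow> 'a) \<Rightarrow> (nat \<Rightarrow> 'a) measure" where
  "update_kernel M n J K ls =
     kernel_prod (path_space M n) (map (\<lambda>l. gibbs_kernel M n (J l) (K (J l))) ls)"

definition update_matrix ::
  "nat \<Rightarrow> (nat \<Rightarrow> nat set) \<Rightarrow> (nat set \<Rightarrow> real mat) \<Rightarrow> nat list \<Rightarrow> real mat" where
  "update_matrix n J W ls = mat_prod n (map (\<lambda>l. W (J l)) (rev ls))"

definition par_kernel ::
  "'a measure \<Rightarrow> nat \<Rightarrow> nat \<Rightarrow> (nat \<Rightarrow> nat set)
     \<Rightarrow> (nat set \<Rightarrow> (nat \<Rightarrow> 'a) \<Rightarrow> (nat \<Rightarrow> 'a) measure)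
     \<Rightarrow> (nat \<Rightarrow> 'a) \<Rightarrow> (nat \<Rightarrow> 'a) measure" where
  "par_kernel M n m J K x =
     update_kernel M n J K (filter odd [1..<m + 1]) x
       \<bind> update_kernel M n J K (filter even [1..<m + 1])"

definition par_matrix ::
  "nat \<Rightarrow> nat \<Rightarrow> (nat \<Rightarrow> nat set) \<Rightarrow> (nat set \<Rightarrow> real mat) \<Rightarrow> real mat" where
  "par_matrix n m J W =
     update_matrix n J W (filter even [1..<m + 1]) * update_matrix n J W (filter odd [1..<m + 1])"

definition left_to_right_kernel ::
  "'a measure \<Rightarrow> nat \<Rightarrow> nat \<Rightarrow> (nat \<Rightarrow> nat set)
     \<Rightarrow> (nat set \<Rightarrow> (nat \<Rightarrow> 'a) \<Rightarrow> (nat \<Rightarrow> 'a) measure)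
     \<Rightarrow> (nat \<Rightarrow> 'a) \<Rightarrow> (nat \<Rightarrow> 'a) measure" where
  "left_to_right_kernel M n m J K = update_kernel M n J K [1..<m + 1]"

definition left_to_right_matrix ::
  "nat \<Rightarrow> nat \<Rightarrow> (nat \<Rightarrow> nat set) \<Rightarrow> (nat set \<Rightarrow> real mat) \<Rightarrow> real mat" where
  "left_to_right_matrix n m J W = update_matrix n J W [1..<m + 1]"

definition left_to_right_rate ::
  "nat \<Rightarrow> (nat \<Rightarrow> nat set) \<Rightarrow> (nat set \<Rightarrow> real mat) \<Rightarrow> real \<Rightarrow> real" where
  "left_to_right_rate m J W lam =
     max0 ((\<lambda>l. lam * entry (W (J l)) (right_boundary (J (l - 1))) (left_boundary (J l))
                + entry (W (J l)) (right_boundary (J (l - 1))) (right_boundary (J l))) ` {2..m})"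

end

theory Submission
  imports Defs
begin

text \<open>
  Along a chain of blocks, updating one block replaces the values of a function on that block by
  combinations of its two boundary values and leaves all other values unchanged. A sweep over the
  blocks thus reads its input only at a small set \<open>R\<close> of boundary points: the boundary points of the
  odd blocks for the parallel sampler, the right boundary points for the left-to-right sampler.
  In other words, the columns of the sampler's matrix \<open>W\<close> outside \<open>R\<close> vanish. Hence every
  factor of \<open>W\<^sup>k\<close> except the first one contributes only through its rows in \<open>R\<close>, and
  \<open>\<parallel>W\<^sup>k\<parallel> \<le> \<parallel>W\<parallel> r\<^sup>k\<^sup>-\<^sup>1\<close> if \<open>r\<close> bounds the sum of every row in \<open>R\<close>
  (\<open>mat_norm_inf_power_le\<close>).

  The row sums follow from the geometry of the chain. Each boundary point of a block lies in a
  neighbouring block (\<open>right_boundary_mem\<close>, \<open>left_boundary_mem\<close>), and no block meets a block further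
  away or its boundary (\<open>far_blocks\<close>). In the parallel sampler, the odd updates therefore do not
  interfere with each other, nor do the even ones; a point of \<open>R\<close> lies in an even block, whose boundary
  lies in odd blocks, so its value is contracted once in each half of the sweep
  (\<open>parallel_sweep_boundary_le\<close>), which gives \<open>r = \<lambda>\<^sup>2\<close>. In the left-to-right sampler, a block finds
  on its left a value that the preceding block has just contracted, and on its right a value that has
  not been touched yet (\<open>left_to_right_sweep_invariant\<close>), which gives \<open>r = \<beta>\<close>. The same estimates
  at arbitrary points give the bounds \<open>2\<close> and \<open>1 + \<lambda>\<close> on \<open>\<parallel>W\<parallel>\<close>.

  That the products are Wasserstein matrices of the composed kernels is the composition rule
  \<open>wasserstein_matrix_bind\<close>; for Gibbs kernels, the required measurability comes from that of the
  conditional distributions (\<open>measurable_gibbs_kernel\<close>).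
\<close>

section \<open>Matrices acting on functions\<close>

lemma entry_mult:
  assumes A: "A \<in> carrier_mat n n" and B: "B \<in> carrier_mat n n"
    and i: "i \<in> {1..n}" and j: "j \<in> {1..n}"
  shows "entry (A * B) i j = (\<Sum>k\<in>{1..n}. entry A i k * entry B k j)"
proof -
  have "entry (A * B) i j = (\<Sum>k\<in>{0..<n}. A $$ (i - 1, k) * B $$ (k, j - 1))"
    using A B i j by (auto simp: entry_def scalar_prod_def intro!: sum.cong)
  also have "\<dots> = (\<Sum>k\<in>{1..n}. A $$ (i - 1, k - 1) * B $$ (k - 1, j - 1))"
    by (rule sum.reindex_bij_witness[of _ "\<lambda>k. k - 1" Suc]) auto
  also have "\<dots> = (\<Sum>k\<in>{1..n}. entry A i k * entry B k j)"
    using A B i j by (auto simp: entry_def intro!: sum.cong)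
  finally show ?thesis .
qed

lemma entry_one:
  "i \<in> {1..n} \<Longrightarrow> j \<in> {1..n} \<Longrightarrow> entry (1\<^sub>m n) i j = (if i = j then 1 else 0)"
  by (auto simp: entry_def)

lemma mat_prod_carrier:
  assumes "set As \<subseteq> carrier_mat n n"
  shows "mat_prod n As \<in> carrier_mat n n"
  using assms unfolding mat_prod_def by (induction As) auto

lemma mat_prod_append:
  assumes "set As \<subseteq> carrier_mat n n" "set Bs \<subseteq> carrier_mat n n"
  shows "mat_prod n (As @ Bs) = mat_prod n As * mat_prod n Bs"
  using assms
proof (induction As)
  case Nil
  then show ?case
    using mat_prod_carrier[OF Nil(2)] by (simp add: mat_prod_def)
next
  case (Cons A As)
  have "mat_prod n ((A # As) @ Bs) = A * (mat_prod n As * mat_prod n Bs)"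
    using Cons by (simp add: mat_prod_def)
  also have "\<dots> = A * mat_prod n As * mat_prod n Bs"
    using mat_prod_carrier[of As n] mat_prod_carrier[of Bs n] Cons.prems
    by (intro assoc_mult_mat[symmetric, of _ n n _ n _ n]) auto
  finally show ?case by (simp add: mat_prod_def)
qed

text \<open>
  The norm of a nonnegative matrix is the largest value of its action on the constant
  function \<open>1\<close>, and the norms of products are easiest to control by following a function
  through the factors one at a time. The action works with the \<open>1\<close>-based
  \<^const>\<open>entry\<close> and with functions on all of \<open>nat\<close>, so that the points \<open>0\<close> and
  \<open>n + 1\<close>, where the entries vanish, need no special treatment.
\<close>
definition act :: "real mat \<Rightarrow> (nat \<Rightarrow> real) \<Rightarrow> nat \<Rightarrow> real" where
  "act A v i = (\<Sum>j\<in>{1..dim_col A}. entry A i j * v j)"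

lemma act_mult:
  assumes A: "A \<in> carrier_mat n n" and B: "B \<in> carrier_mat n n" and i: "i \<in> {1..n}"
  shows "act (A * B) v i = act A (act B v) i"
proof -
  have "act (A * B) v i = (\<Sum>j\<in>{1..n}. \<Sum>k\<in>{1..n}. entry A i k * entry B k j * v j)"
    using assms unfolding act_def
    by (auto simp: entry_mult[OF A B i] sum_distrib_right intro!: sum.cong)
  also have "\<dots> = (\<Sum>k\<in>{1..n}. \<Sum>j\<in>{1..n}. entry A i k * entry B k j * v j)"
    by (rule sum.swap)
  also have "\<dots> = act A (act B v) i"
    using A B unfolding act_def by (simp add: sum_distrib_left mult.assoc)
  finally show ?thesis .
qed

lemma act_one: "i \<in> {1..n} \<Longrightarrow> act (1\<^sub>m n) v i = v i"
  by (simp add: act_def entry_one if_distrib[of "\<lambda>x. x * v _"] sum.delta cong: if_cong)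

lemma act_cong: 
  "A \<in> carrier_mat n n \<Longrightarrow> (\<And>j. j \<in> {1..n} \<Longrightarrow> v j = w j) \<Longrightarrow> act A v i = act A w i"
  unfolding act_def by (intro sum.cong) auto

definition nonneg_mat :: "real mat \<Rightarrow> bool" where
  "nonneg_mat A \<longleftrightarrow> (\<forall>i j. 0 \<le> entry A i j)"

lemma nonneg_mat_mult:
  assumes "A \<in> carrier_mat n n" "B \<in> carrier_mat n n" "nonneg_mat A" "nonneg_mat B"
  shows "nonneg_mat (A * B)"
  unfolding nonneg_mat_def
proof (intro allI)
  fix i j
  show "0 \<le> entry (A * B) i j"
  proof (cases "i \<in> {1..n} \<and> j \<in> {1..n}")
    case True
    then show ?thesis
      using assms by (auto simp: entry_mult[of A n B] nonneg_mat_def intro!: sum_nonneg)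
  next
    case False
    then show ?thesis using assms by (auto simp: entry_def)
  qed
qed

lemma nonneg_mat_one: "nonneg_mat (1\<^sub>m n)"
  by (auto simp: nonneg_mat_def entry_def)

lemma mat_norm_inf_le_iff:
  assumes A: "A \<in> carrier_mat n n" "nonneg_mat A" and n: "1 \<le> n"
  shows "mat_norm_inf A \<le> c \<longleftrightarrow> (\<forall>i\<in>{1..n}. act A (\<lambda>_. 1) i \<le> c)"
proof -
  have "mat_norm_inf A = Max (act A (\<lambda>_. 1) ` {1..n})"
    using assms by (auto simp: mat_norm_inf_def max0_def act_def nonneg_mat_def)
  then show ?thesis using n by auto
qed

text \<open>
  If \<open>A\<close> has nonzero columns only in \<open>R\<close>, then only the rows of \<open>A\<close> in \<open>R\<close> matter when a
  further factor \<open>A\<close> is multiplied on the right: for \<open>k \<ge> 1\<close>, a row sum of \<open>A\<^sup>k\<^sup>+\<^sup>1\<close>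
  combines the sums of the rows of \<open>A\<close> in \<open>R\<close>, with weights from the same row of \<open>A\<^sup>k\<close>. The
  rate is therefore governed by the rows in \<open>R\<close>, although other rows of \<open>A\<close> may have a sum above \<open>1\<close>.
\<close>
lemma mat_norm_inf_power_le:
  assumes A: "A \<in> carrier_mat n n" "nonneg_mat A" and n: "1 \<le> n" and r: "0 \<le> r"
    and zero: "\<And>i j. i \<in> {1..n} \<Longrightarrow> j \<in> {1..n} - R \<Longrightarrow> entry A i j = 0"
    and row: "\<And>j. j \<in> R \<Longrightarrow> j \<in> {1..n} \<Longrightarrow> act A (\<lambda>_. 1) j \<le> r"
  shows "mat_norm_inf (A ^\<^sub>m Suc k) \<le> mat_norm_inf A * r ^ k"
proof (induction k)
  case 0
  then show ?case using A by simp
next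
  case (Suc k)
  have carr: "A ^\<^sub>m l \<in> carrier_mat n n" for l
    using A by simp
  have nonneg_pow: "nonneg_mat (A ^\<^sub>m l)" for l
    using A by (induction l) (auto intro: nonneg_mat_mult[OF carr] nonneg_mat_one)
  \<comment> \<open>The last factor of a positive power is \<open>A\<close>, so its columns outside \<open>R\<close> vanish too.\<close>
  have zero_pow: "entry (A ^\<^sub>m Suc k) i j = 0" if "i \<in> {1..n}" "j \<in> {1..n} - R" for i j
  proof -
    have "entry (A ^\<^sub>m k * A) i j = (\<Sum>l\<in>{1..n}. entry (A ^\<^sub>m k) i l * entry A l j)"
      using that A by (intro entry_mult[OF carr]) auto
    then show ?thesis using zero that by simp
  qed
  have "act (A ^\<^sub>m Suc (Suc k)) (\<lambda>_. 1) i \<le> mat_norm_inf (A ^\<^sub>m Suc k) * r" if i: "i \<in> {1..n}" for i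
  proof -
    have "act (A ^\<^sub>m Suc (Suc k)) (\<lambda>_. 1) i
        = (\<Sum>j\<in>{1..n}. entry (A ^\<^sub>m Suc k) i j * act A (\<lambda>_. 1) j)"
      using act_mult[OF carr[of "Suc k"] A(1) i, of "\<lambda>_. 1"] carr[of "Suc k"] A(1)
      by (simp add: act_def)
    also have "\<dots> \<le> (\<Sum>j\<in>{1..n}. entry (A ^\<^sub>m Suc k) i j * r)"
    proof (rule sum_mono)
      fix j assume j: "j \<in> {1..n}"
      show "entry (A ^\<^sub>m Suc k) i j * act A (\<lambda>_. 1) j \<le> entry (A ^\<^sub>m Suc k) i j * r"
      proof (cases "j \<in> R")
        case True
        then show ?thesis
          using row[OF True j] nonneg_pow[of "Suc k"]
          by (intro mult_left_mono) (auto simp: nonneg_mat_def)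
      next
        case False
        then show ?thesis using zero_pow[OF i, of j] j by simp
      qed
    qed
    also have "\<dots> = act (A ^\<^sub>m Suc k) (\<lambda>_. 1) i * r"
      using A by (simp add: act_def sum_distrib_right)
    also have "\<dots> \<le> mat_norm_inf (A ^\<^sub>m Suc k) * r"
      using mat_norm_inf_le_iff[OF carr nonneg_pow n, of "Suc k" "mat_norm_inf (A ^\<^sub>m Suc k)"] i r
      by (intro mult_right_mono) blast+
    finally show ?thesis .
  qed
  then have "mat_norm_inf (A ^\<^sub>m Suc (Suc k)) \<le> mat_norm_inf (A ^\<^sub>m Suc k) * r"
    using mat_norm_inf_le_iff[OF carr nonneg_pow n] by blast
  also have "\<dots> \<le> mat_norm_inf A * r ^ k * r"
    using Suc r by (intro mult_right_mono) auto
  finally show ?case by (simp add: mult.assoc mult.left_commute mult.commute[of r])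
qed

text \<open>
  The form of the previous bound that is checked for the samplers below. The assumptions on the
  action cover both rows and columns of \<open>A\<close>: the constant function \<open>1\<close> with \<open>c = 1\<close> gives the
  row sums, and the indicator of a point outside \<open>R\<close> with \<open>c = 0\<close> shows that its column vanishes.
\<close>
lemma mat_norm_inf_le_of_act_le:
  assumes A: "A \<in> carrier_mat n n" "nonneg_mat A" and n: "1 \<le> n" and r: "0 \<le> r" and k: "1 \<le> k"
    and bound: "\<And>v c i. 0 \<le> c \<Longrightarrow> (\<And>j. j \<in> R \<Longrightarrow> v j \<le> c) \<Longrightarrow> i \<in> {1..n}
                  \<Longrightarrow> act A v i \<le> C * c"
    and bound_R: "\<And>v c i. 0 \<le> c \<Longrightarrow> (\<And>j. j \<in> R \<Longrightarrow> v j \<le> c) \<Longrightarrow> i \<in> {1..n}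
                  \<Longrightarrow> i \<in> R \<Longrightarrow> act A v i \<le> r * c"
  shows "mat_norm_inf (A ^\<^sub>m k) \<le> mat_norm_inf A * r ^ (k - 1)"
    and "mat_norm_inf A \<le> C"
proof -
  show "mat_norm_inf A \<le> C"
    using mat_norm_inf_le_iff[OF A n] bound[of 1 "\<lambda>_. 1"] by auto
  have "entry A i j = 0" if ij: "i \<in> {1..n}" "j \<in> {1..n} - R" for i j
  proof -
    have "act A (\<lambda>l. if l = j then 1 else 0) i \<le> C * 0"
      using ij by (intro bound) auto
    moreover have "act A (\<lambda>l. if l = j then 1 else 0) i = entry A i j"
      using ij A by (simp add: act_def if_distrib[of "\<lambda>x. _ * x"] sum.delta cong: if_cong)
    ultimately show ?thesis
      using A(2) by (auto simp: nonneg_mat_def intro: antisym)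
  qed
  moreover have "act A (\<lambda>_. 1) j \<le> r" if "j \<in> R" "j \<in> {1..n}" for j
    using bound_R[of 1 "\<lambda>_. 1" j] that by simp
  ultimately have "mat_norm_inf (A ^\<^sub>m Suc (k - 1)) \<le> mat_norm_inf A * r ^ (k - 1)"
    by (intro mat_norm_inf_power_le[OF A n r, where R=R]) auto
  then show "mat_norm_inf (A ^\<^sub>m k) \<le> mat_norm_inf A * r ^ (k - 1)"
    using k by simp
qed

section \<open>Wasserstein matrices of composed kernels\<close>

lemma finite_oscillation_imp_bounded:
  assumes "finite_oscillation S f"
  obtains B :: real where "\<And>x. x \<in> S \<Longrightarrow> \<bar>f x\<bar> \<le> B"
proof (cases "S = {}")
  case True
  then show thesis using that[of 0] by simp
next
  case False
  then obtain a where a: "a \<in> S" by blast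
  obtain b where b: "\<And>x z. x \<in> S \<Longrightarrow> z \<in> S \<Longrightarrow> \<bar>f x - f z\<bar> \<le> b"
    using assms unfolding finite_oscillation_def bdd_above_def by blast
  show thesis
  proof (rule that[of "\<bar>f a\<bar> + \<bar>b\<bar>"])
    show "\<bar>f x\<bar> \<le> \<bar>f a\<bar> + \<bar>b\<bar>" if "x \<in> S" for x
      using b[OF that a] by linarith
  qed
qed

lemma bounded_imp_finite_oscillation:
  assumes "\<And>x. x \<in> S \<Longrightarrow> \<bar>f x\<bar> \<le> B"
  shows "finite_oscillation S f"
  unfolding finite_oscillation_def
proof (rule bdd_aboveI)
  fix d assume "d \<in> {\<bar>f x - f z\<bar> | x z. x \<in> S \<and> z \<in> S}"
  then obtain x z where "d = \<bar>f x - f z\<bar>" "x \<in> S" "z \<in> S" by blast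
  then show "d \<le> 2 * B" using assms[of x] assms[of z] by linarith
qed

lemma osc_cong:
  assumes "\<And>x. x \<in> S \<Longrightarrow> f x = g x"
  shows "osc S i f = osc S i g"
proof -
  have "{\<bar>f x - f z\<bar> | x z. x \<in> S \<and> z \<in> S \<and> (\<forall>j. j \<noteq> i \<longrightarrow> x j = z j)}
      = {\<bar>g x - g z\<bar> | x z. x \<in> S \<and> z \<in> S \<and> (\<forall>j. j \<noteq> i \<longrightarrow> x j = z j)}"
    using assms by (auto; metis)
  then show ?thesis unfolding osc_def by simp
qed

lemma abs_integral_prob_le:
  fixes f :: "'s \<Rightarrow> real"
  assumes "\<nu> \<in> space (prob_algebra S)" "f \<in> borel_measurable S" "\<And>x. x \<in> space S \<Longrightarrow> \<bar>f x\<bar> \<le> B"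
  shows "\<bar>\<integral>x. f x \<partial>\<nu>\<bar> \<le> B"
proof -
  interpret prob_space \<nu> using assms by (auto simp: space_prob_algebra)
  have sets: "sets \<nu> = sets S" using assms by (auto simp: space_prob_algebra)
  have space: "space \<nu> = space S" using sets_eq_imp_space_eq[OF sets] .
  have f: "f \<in> borel_measurable \<nu>"
    using assms(2) sets measurable_cong_sets by blast
  have int: "integrable \<nu> f"
    using assms(3) space by (intro integrable_const_bound[of _ B]) (auto intro!: AE_I2 f)
  have "\<bar>\<integral>x. f x \<partial>\<nu>\<bar> \<le> (\<integral>x. \<bar>f x\<bar> \<partial>\<nu>)" by (rule integral_abs_bound)
  also have "\<dots> \<le> (\<integral>x. B \<partial>\<nu>)"
    using assms(3) space int by (intro integral_mono) auto
  finally show ?thesis by (simp add: prob_space)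
qed

lemma integral_prob_bind:
  fixes f :: "'s \<Rightarrow> real"
  assumes \<nu>: "\<nu> \<in> space (prob_algebra S)" and Q: "Q \<in> measurable S (prob_algebra S)"
    and f: "f \<in> borel_measurable S" "\<And>x. x \<in> space S \<Longrightarrow> \<bar>f x\<bar> \<le> B"
  shows "(\<integral>x. f x \<partial>(\<nu> \<bind> Q)) = (\<integral>x. (\<integral>z. f z \<partial>Q x) \<partial>\<nu>)"
proof -
  interpret prob_space \<nu> using \<nu> by (auto simp: space_prob_algebra)
  have sets: "sets \<nu> = sets S" using \<nu> by (auto simp: space_prob_algebra)
  have Q': "Q \<in> measurable \<nu> (prob_algebra S)" using Q sets measurable_cong_sets by blast
  show ?thesis
  proof (rule integral_bind[where K=S and B=B and B'=1])
    show "AE x in \<nu>. emeasure (Q x) (space (Q x)) \<le> ennreal 1"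
      using measurable_space[OF Q']
      by (auto simp: space_prob_algebra prob_space.emeasure_space_1 intro!: AE_I2)
  qed (use f Q' in \<open>auto intro: measurable_prob_algebraD finite_measure_axioms\<close>)
qed

text \<open>
  Apply the defining inequality of \<open>V\<close> to the function \<open>h = Q f\<close>, then that of \<open>W\<close> to \<open>f\<close>.
  The kernels have to be measurable, and have to consist of probability measures, for \<open>h\<close> to be an
  admissible function and for \<open>(P Q) f = P (Q f)\<close> to hold.
\<close>
lemma wasserstein_matrix_bind:
  assumes P: "P \<in> measurable (path_space M n) (prob_algebra (path_space M n))"
    and Q: "Q \<in> measurable (path_space M n) (prob_algebra (path_space M n))"
    and V: "wasserstein_matrix M n P V" and W: "wasserstein_matrix M n Q W"
  shows "wasserstein_matrix M n (\<lambda>x. P x \<bind> Q) (W * V)"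
proof -
  let ?S = "path_space M n"
  let ?X = "space (path_space M n)"
  have carrier: "V \<in> carrier_mat n n" "W \<in> carrier_mat n n"
    using V W by (auto simp: wasserstein_matrix_def)
  have nonneg: "0 \<le> entry V i j" "0 \<le> entry W i j" if "i \<in> {1..n}" "j \<in> {1..n}" for i j
    using V W that by (auto simp: wasserstein_matrix_def)
  have osc_le: "osc ?X j (\<lambda>x. \<integral>x'. f x' \<partial>(P x \<bind> Q)) \<le> (\<Sum>i\<in>{1..n}. osc ?X i f * entry (W * V) i j)"
    if f: "f \<in> borel_measurable ?S" and osc: "finite_oscillation ?X f" and j: "j \<in> {1..n}" for f j
  proof -
    obtain B where B: "\<And>x. x \<in> ?X \<Longrightarrow> \<bar>f x\<bar> \<le> B"
      using finite_oscillation_imp_bounded[OF osc] by blast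
    define h where "h x = (\<integral>z. f z \<partial>Q x)" for x
    have h: "h \<in> borel_measurable ?S"
      unfolding h_def
      by (rule measurable_compose[OF measurable_prob_algebraD[OF Q]
            integral_measurable_subprob_algebra[OF f]])
    have h_osc: "finite_oscillation ?X h"
      unfolding h_def
      by (rule bounded_imp_finite_oscillation[of _ _ B])
         (auto intro!: abs_integral_prob_le[OF measurable_space[OF Q] f] B)
    have "osc ?X j (\<lambda>x. \<integral>x'. f x' \<partial>(P x \<bind> Q)) = osc ?X j (\<lambda>x. \<integral>x'. h x' \<partial>P x)"
      unfolding h_def
      by (rule osc_cong) (rule integral_prob_bind[OF measurable_space[OF P] Q f B])
    also have "\<dots> \<le> (\<Sum>l\<in>{1..n}. osc ?X l h * entry V l j)"
      using V h h_osc j by (auto simp: wasserstein_matrix_def)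
    also have "\<dots> \<le> (\<Sum>l\<in>{1..n}. (\<Sum>i\<in>{1..n}. osc ?X i f * entry W i l) * entry V l j)"
    proof (intro sum_mono mult_right_mono nonneg j)
      fix l assume "l \<in> {1..n}"
      then show "osc ?X l h \<le> (\<Sum>i\<in>{1..n}. osc ?X i f * entry W i l)"
        using W f osc unfolding h_def by (auto simp: wasserstein_matrix_def)
    qed
    also have "\<dots> = (\<Sum>i\<in>{1..n}. \<Sum>l\<in>{1..n}. osc ?X i f * entry W i l * entry V l j)"
      unfolding sum_distrib_right by (rule sum.swap)
    also have "\<dots> = (\<Sum>i\<in>{1..n}. osc ?X i f * entry (W * V) i j)"
      using entry_mult[OF carrier(2,1)] j by (simp add: sum_distrib_left mult.assoc)
    finally show ?thesis .
  qed
  show ?thesis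
    unfolding wasserstein_matrix_def
    using carrier nonneg osc_le
    by (auto simp: entry_mult[OF carrier(2,1)] intro!: sum_nonneg)
qed

text \<open>
  The integral of \<open>f\<close> against a Dirac measure is the value of \<open>f\<close> there, so the inequality of the
  definition is an equality.
\<close>
lemma wasserstein_matrix_return: "wasserstein_matrix M n (return (path_space M n)) (1\<^sub>m n)"
proof -
  have "osc (space (path_space M n)) j (\<lambda>x. \<integral>x'. f x' \<partial>return (path_space M n) x)
      = (\<Sum>i\<in>{1..n}. osc (space (path_space M n)) i f * entry (1\<^sub>m n) i j)"
    if f: "f \<in> borel_measurable (path_space M n)" and j: "j \<in> {1..n}" for f j
  proof -
    have "osc (space (path_space M n)) j (\<lambda>x. \<integral>x'. f x' \<partial>return (path_space M n) x)
        = osc (space (path_space M n)) j f"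
      by (rule osc_cong) (rule integral_return[OF _ f])
    also have "\<dots> = (\<Sum>i\<in>{1..n}. osc (space (path_space M n)) i f * entry (1\<^sub>m n) i j)"
      using j by (simp add: entry_one if_distrib[of "\<lambda>x. _ * x"] sum.delta cong: if_cong)
    finally show ?thesis .
  qed
  then show ?thesis
    unfolding wasserstein_matrix_def by (auto simp: entry_one)
qed

lemma measurable_gibbs_kernel:
  assumes K: "K \<in> measurable (PiM ({1..n} - J) (\<lambda>_. M)) (prob_algebra (PiM J (\<lambda>_. M)))"
    and J: "J \<subseteq> {1..n}"
  shows "gibbs_kernel M n J K \<in> measurable (path_space M n) (prob_algebra (path_space M n))"
proof -
  let ?C = "{1..n} - J"
  have restrict: "(\<lambda>x. restrict x ?C) \<in> measurable (path_space M n) (PiM ?C (\<lambda>_. M))"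
    by (rule measurable_restrict_subset) auto
  \<comment> \<open>\<open>merge\<close> reads its second argument on \<open>?C\<close> only.\<close>
  have merge_restrict: "merge J ?C (z, x) = merge J ?C (z, restrict x ?C)" for z x :: "nat \<Rightarrow> 'a"
    by (auto simp: merge_def fun_eq_iff)
  have "(\<lambda>w. (snd w, restrict (fst w) ?C))
      \<in> measurable (path_space M n \<Otimes>\<^sub>M PiM J (\<lambda>_. M)) (PiM J (\<lambda>_. M) \<Otimes>\<^sub>M PiM ?C (\<lambda>_. M))"
    by (intro measurable_Pair measurable_snd measurable_compose[OF measurable_fst restrict])
  from measurable_compose[OF this measurable_merge]
  have "(\<lambda>(x, z). merge J ?C (z, x))
      \<in> measurable (path_space M n \<Otimes>\<^sub>M PiM J (\<lambda>_. M)) (PiM (J \<union> ?C) (\<lambda>_. M))"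
    by (subst merge_restrict) (simp add: case_prod_beta)
  moreover have "J \<union> ?C = {1..n}" using J by auto
  ultimately show ?thesis
    unfolding gibbs_kernel_def[abs_def]
    by (intro measurable_distr_prob_space2[where M="PiM J (\<lambda>_. M)"] measurable_compose[OF restrict K])
       (simp only:)
qed

lemma update_kernel_wasserstein:
  assumes meas: "\<And>l. l \<in> set ls \<Longrightarrow>
      gibbs_kernel M n (J l) (K (J l)) \<in> measurable (path_space M n) (prob_algebra (path_space M n))"
    and W: "\<And>l. l \<in> set ls \<Longrightarrow> wasserstein_matrix M n (gibbs_kernel M n (J l) (K (J l))) (W (J l))"
  shows "update_kernel M n J K ls \<in> measurable (path_space M n) (prob_algebra (path_space M n))
       \<and> wasserstein_matrix M n (update_kernel M n J K ls) (update_matrix n J W ls)"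
  using assms
proof (induction ls)
  case Nil
  show ?case
    using wasserstein_matrix_return[of M n]
    by (simp add: update_kernel_def update_matrix_def kernel_prod_def mat_prod_def
        del: One_nat_def)
next
  case (Cons l ls)
  have kernel: "update_kernel M n J K (l # ls)
      = (\<lambda>x. gibbs_kernel M n (J l) (K (J l)) x \<bind> update_kernel M n J K ls)"
    by (simp add: update_kernel_def kernel_prod_def)
  have carrier: "W (J l') \<in> carrier_mat n n" if "l' \<in> set (l # ls)" for l'
    using Cons.prems(2)[OF that] by (simp add: wasserstein_matrix_def)
  have "update_matrix n J W (l # ls) = update_matrix n J W ls * mat_prod n [W (J l)]"
    using carrier by (simp add: update_matrix_def mat_prod_append image_subset_iff)
  then have matrix: "update_matrix n J W (l # ls) = update_matrix n J W ls * W (J l)"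
    using carrier[of l] by (simp add: mat_prod_def)
  have IH: "update_kernel M n J K ls \<in> measurable (path_space M n) (prob_algebra (path_space M n))"
      "wasserstein_matrix M n (update_kernel M n J K ls) (update_matrix n J W ls)"
    using Cons by auto
  show ?case
    unfolding kernel matrix
    using measurable_bind_prob_space[OF Cons.prems(1) IH(1)]
      wasserstein_matrix_bind[OF Cons.prems(1) IH(1) Cons.prems(2) IH(2)] by simp
qed

section \<open>Chains of overlapping blocks\<close>

text \<open>
  A Wasserstein matrix of block \<open>l\<close>, which occupies \<open>{s l..u l}\<close>, sends \<open>v\<close> to a function that
  agrees with \<open>v\<close> off the block and that combines the two values \<open>v (s l - 1)\<close> and \<open>v (u l + 1)\<close>
  on the block, with weights \<open>a l i\<close> and \<open>b l i\<close>. The locale keeps only this data, so that norm bounds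
  turn into statements about how an upper bound on \<open>v\<close> at a few points propagates through the
  updates. The assumptions \<open>a_zero\<close> and \<open>b_zero\<close> express that a block at an end of
  \<open>{1..n}\<close> has no boundary point on that side; \<open>contraction\<close> concerns points of a block that
  are boundary points of some block.
\<close>
locale block_chain =
  fixes n m :: nat and s u :: "nat \<Rightarrow> nat" and a b :: "nat \<Rightarrow> nat \<Rightarrow> real" and lam :: real
  assumes block: "\<And>l. l \<in> {1..m} \<Longrightarrow> 1 \<le> s l \<and> s l \<le> u l \<and> u l \<le> n"
    and ordered: "\<And>j l. 1 \<le> j \<Longrightarrow> j < l \<Longrightarrow> l \<le> m \<Longrightarrow> s j < s l \<and> u j < u l"
    and separated: "\<And>j l. 1 \<le> j \<Longrightarrow> j + 2 \<le> l \<Longrightarrow> l \<le> m \<Longrightarrow> u j + 1 < s l"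
    and cover: "\<And>i. i \<in> {1..n} \<Longrightarrow> \<exists>l\<in>{1..m}. i \<in> {s l..u l}"
    and a_range: "\<And>l i. l \<in> {1..m} \<Longrightarrow> i \<in> {s l..u l} \<Longrightarrow> a l i \<in> {0..1}"
    and b_range: "\<And>l i. l \<in> {1..m} \<Longrightarrow> i \<in> {s l..u l} \<Longrightarrow> b l i \<in> {0..1}"
    and a_zero: "\<And>l i. l \<in> {1..m} \<Longrightarrow> s l = 1 \<Longrightarrow> a l i = 0"
    and b_zero: "\<And>l i. l \<in> {1..m} \<Longrightarrow> u l = n \<Longrightarrow> b l i = 0"
    and contraction: "\<And>l l' i. l \<in> {1..m} \<Longrightarrow> i \<in> {s l..u l} \<Longrightarrow> l' \<in> {1..m}
                        \<Longrightarrow> i + 1 = s l' \<or> i = u l' + 1 \<Longrightarrow> a l i + b l i \<le> lam"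
    and lam: "0 \<le> lam" "lam \<le> 1"
begin

definition update :: "nat \<Rightarrow> (nat \<Rightarrow> real) \<Rightarrow> nat \<Rightarrow> real" where
  "update l v i = (if i \<in> {s l..u l} then a l i * v (s l - 1) + b l i * v (u l + 1) else v i)"

text \<open>
  The point to the right of block \<open>l\<close> must be covered: blocks up to \<open>l\<close> end too early, and
  blocks from \<open>l + 2\<close> onwards start too late, by separation.
\<close>
lemma right_boundary_mem:
  assumes "1 \<le> l" "l < m"
  shows "u l + 1 \<in> {s (l + 1)..u (l + 1)}"
proof -
  have u: "u l < u (l + 1)" "u (l + 1) \<le> n"
    using ordered[of l "l + 1"] block[of "l + 1"] assms by auto
  then obtain j where j: "j \<in> {1..m}" "u l + 1 \<in> {s j..u j}" using cover[of "u l + 1"] by auto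
  have "l < j"
  proof (rule ccontr)
    assume "\<not> l < j"
    then have "u j \<le> u l" using ordered[of j l] assms j by (cases "j = l") auto
    then show False using j by auto
  qed
  moreover have "\<not> l + 2 \<le> j" using separated[of l j] assms j by auto
  ultimately have "j = l + 1" by simp
  then show ?thesis using j by simp
qed

lemma left_boundary_mem:
  assumes "1 \<le> l" "l < m"
  shows "s (l + 1) - 1 \<in> {s l..u l}"
  using right_boundary_mem[OF assms] ordered[of l "l + 1"] assms by auto

lemma first_block: "l \<in> {1..m} \<Longrightarrow> s 1 = 1"
proof -
  assume l: "l \<in> {1..m}"
  then have "1 \<in> {1..n}" using block[of l] by auto
  then obtain j where "j \<in> {1..m}" "1 \<in> {s j..u j}" using cover by blast
  then show ?thesis using block[of 1] ordered[of 1 j] by (cases "j = 1") auto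
qed

lemma last_block: "l \<in> {1..m} \<Longrightarrow> u m = n"
proof -
  assume l: "l \<in> {1..m}"
  then have "n \<in> {1..n}" using block[of l] by auto
  then obtain j where "j \<in> {1..m}" "n \<in> {s j..u j}" using cover by blast
  then show ?thesis using block[of m] ordered[of j m] by (cases "j = m") auto
qed

text \<open>
  The first block has no left boundary point, but its weight \<open>a\<close> vanishes. This allows bounds that
  ignore the exception: a bound on \<open>v\<close> at the boundary point is required only if this point exists.
\<close>
lemma left_term_le:
  assumes l: "l \<in> {1..m}" "i \<in> {s l..u l}"
    and v: "l \<noteq> 1 \<Longrightarrow> v (s l - 1) \<le> d"
  shows "a l i * v (s l - 1) \<le> a l i * d"
proof (cases "l = 1")
  case True
  then show ?thesis using a_zero[of l i] first_block[of l] l by simp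
next
  case False
  then show ?thesis using a_range[OF l] v by (auto intro: mult_left_mono)
qed

lemma right_term_le:
  assumes l: "l \<in> {1..m}" "i \<in> {s l..u l}"
    and v: "l \<noteq> m \<Longrightarrow> v (u l + 1) \<le> d"
  shows "b l i * v (u l + 1) \<le> b l i * d"
proof (cases "l = m")
  case True
  then show ?thesis using b_zero[of l i] last_block[of l] l by simp
next
  case False
  then show ?thesis using b_range[OF l] v by (auto intro: mult_left_mono)
qed

lemma update_le:
  assumes "l \<in> {1..m}" "i \<in> {s l..u l}"
    and "l \<noteq> 1 \<Longrightarrow> v (s l - 1) \<le> d" "l \<noteq> m \<Longrightarrow> v (u l + 1) \<le> e"
  shows "update l v i \<le> a l i * d + b l i * e"
  using left_term_le[of l i v d] right_term_le[of l i v e] assms by (simp add: update_def)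

lemma update_le_twice:
  assumes l: "l \<in> {1..m}" "i \<in> {s l..u l}" and d: "0 \<le> d"
    and v: "l \<noteq> 1 \<Longrightarrow> v (s l - 1) \<le> d" "l \<noteq> m \<Longrightarrow> v (u l + 1) \<le> d"
  shows "update l v i \<le> 2 * d"
proof -
  have "update l v i \<le> a l i * d + b l i * d" using assms by (intro update_le)
  also have "\<dots> \<le> 1 * d + 1 * d"
    using a_range[OF l] b_range[OF l] d by (intro add_mono mult_right_mono) auto
  finally show ?thesis by simp
qed

lemma update_le_contraction:
  assumes l: "l \<in> {1..m}" "i \<in> {s l..u l}" and d: "0 \<le> d"
    and v: "l \<noteq> 1 \<Longrightarrow> v (s l - 1) \<le> d" "l \<noteq> m \<Longrightarrow> v (u l + 1) \<le> d"
    and i: "l' \<in> {1..m}" "i + 1 = s l' \<or> i = u l' + 1"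
  shows "update l v i \<le> lam * d"
proof -
  have "update l v i \<le> a l i * d + b l i * d" using assms by (intro update_le)
  also have "\<dots> = (a l i + b l i) * d" by (simp add: distrib_right)
  also have "\<dots> \<le> lam * d"
    using contraction[OF l i] d by (intro mult_right_mono) auto
  finally show ?thesis .
qed

lemma sweep_outside:
  assumes "\<And>l. l \<in> set ls \<Longrightarrow> i \<notin> {s l..u l}"
  shows "fold update ls v i = v i"
  using assms
proof (induction ls arbitrary: v)
  case (Cons l ls)
  have "i \<notin> {s l..u l}" using Cons.prems by simp
  then have "update l v i = v i" unfolding update_def by (rule if_not_P)
  then show ?case using Cons by simp
qed simp

text \<open>
  Two blocks whose indices differ by at least \<open>2\<close> leave a gap, so that neither of them meets the
  other one or its boundary points.
\<close>
lemma far_blocks: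
  assumes "j \<in> {1..m}" "l \<in> {1..m}" "j + 2 \<le> l \<or> l + 2 \<le> j" "i \<in> {s l - 1..u l + 1}"
  shows "i \<notin> {s j..u j}"
  using separated[of j l] separated[of l j] assms by auto

text \<open>
  Updating a block changes neither the other blocks nor the boundary values that they read. The order
  of the updates is therefore irrelevant, and they act as one simultaneous update.
\<close>
lemma sweep_far_blocks:
  assumes "distinct ls" "set ls \<subseteq> {1..m}"
    and "\<And>j l. j \<in> set ls \<Longrightarrow> l \<in> set ls \<Longrightarrow> j \<noteq> l \<Longrightarrow> j + 2 \<le> l \<or> l + 2 \<le> j"
    and "l \<in> set ls" "i \<in> {s l..u l}"
  shows "fold update ls v i = update l v i"
  using assms
proof (induction ls arbitrary: v)
  case (Cons x xs)
  show ?case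
  proof (cases "l = x")
    case True
    \<comment> \<open>The blocks that follow leave the value at \<open>i\<close> alone.\<close>
    have "i \<notin> {s j..u j}" if "j \<in> set xs" for j
      using Cons.prems that True by (intro far_blocks[of j l]) auto
    then show ?thesis using True sweep_outside[of xs i "update x v"] by simp
  next
    case False
    then have lxs: "l \<in> set xs" using Cons.prems by simp
    \<comment> \<open>The update of block \<open>x\<close> comes first, but block \<open>l\<close> does not read from block \<open>x\<close>.\<close>
    have far: "j \<notin> {s x..u x}" if "j \<in> {s l - 1..u l + 1}" for j
      using Cons.prems that False by (intro far_blocks[of x l]) auto
    have l: "s l \<le> u l" using Cons.prems by auto
    have "update x v (s l - 1) = v (s l - 1)" "update x v (u l + 1) = v (u l + 1)"
      unfolding update_def using l by (intro if_not_P far; simp)+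
    then have "update l (update x v) i = update l v i"
      using Cons.prems(5) by (simp add: update_def)
    moreover have "fold update xs (update x v) i = update l (update x v) i"
      using Cons.prems lxs by (intro Cons.IH) auto
    ultimately show ?thesis by simp
  qed
qed simp

subsection \<open>The parallel sweep\<close>

definition odd_sweep :: "(nat \<Rightarrow> real) \<Rightarrow> nat \<Rightarrow> real" where
  "odd_sweep = fold update (filter odd [1..<m + 1])"

definition even_sweep :: "(nat \<Rightarrow> real) \<Rightarrow> nat \<Rightarrow> real" where
  "even_sweep = fold update (filter even [1..<m + 1])"

lemma same_parity_far:
  fixes j l :: nat
  assumes "even j = even l" "j \<noteq> l"
  shows "j + 2 \<le> l \<or> l + 2 \<le> j"
  using assms by presburger

lemma sweep_same_parity:
  assumes Q: "\<And>j l. Q j \<Longrightarrow> Q l \<Longrightarrow> even j = even l"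
    and l: "l \<in> {1..m}" "Q l" "i \<in> {s l..u l}"
  shows "fold update (filter Q [1..<m + 1]) v i = update l v i"
proof (rule sweep_far_blocks)
  have set_eq: "set (filter Q [1..<m + 1]) = {l \<in> {1..m}. Q l}" by auto
  show "j + 2 \<le> l' \<or> l' + 2 \<le> j"
    if "j \<in> set (filter Q [1..<m + 1])" "l' \<in> set (filter Q [1..<m + 1])" "j \<noteq> l'" for j l'
  proof (rule same_parity_far)
    show "even j = even l'" using that unfolding set_eq by (intro Q) auto
  qed fact
  show "l \<in> set (filter Q [1..<m + 1])" unfolding set_eq using l by simp
qed (use l in auto)

lemma odd_sweep_eq:
  assumes "l \<in> {1..m}" "odd l" "i \<in> {s l..u l}"
  shows "odd_sweep v i = update l v i"
  unfolding odd_sweep_def using assms by (intro sweep_same_parity) auto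

lemma even_sweep_eq:
  assumes "l \<in> {1..m}" "even l" "i \<in> {s l..u l}"
  shows "even_sweep v i = update l v i"
  unfolding even_sweep_def using assms by (intro sweep_same_parity) auto

lemma even_sweep_outside:
  assumes "\<And>l. l \<in> {1..m} \<Longrightarrow> even l \<Longrightarrow> i \<notin> {s l..u l}"
  shows "even_sweep v i = v i"
  unfolding even_sweep_def by (rule sweep_outside) (use assms in auto)

definition odd_boundary :: "nat set" where
  "odd_boundary = {i \<in> {1..n}. \<exists>l\<in>{1..m}. odd l \<and> (i + 1 = s l \<or> i = u l + 1)}"

lemma left_mem_odd_boundary:
  assumes "l \<in> {1..m}" "odd l" "l \<noteq> 1"
  shows "s l - 1 \<in> odd_boundary"
proof -
  have "1 < s l" using ordered[of 1 l] block[of 1] assms by auto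
  then show ?thesis using assms block[of l] by (auto simp: odd_boundary_def intro!: bexI[of _ l])
qed

lemma right_mem_odd_boundary:
  assumes "l \<in> {1..m}" "odd l" "l \<noteq> m"
  shows "u l + 1 \<in> odd_boundary"
proof -
  have "u l < n" using ordered[of l m] block[of m] assms by auto
  then show ?thesis using assms by (auto simp: odd_boundary_def)
qed

text \<open>
  Boundary points of an odd block lie in the neighbouring block, which is even. The second index
  records that they are boundary points, which is what the contraction assumption asks for.
\<close>
lemma odd_boundary_mem_even_block:
  assumes "i \<in> odd_boundary"
  obtains l l' where "l \<in> {1..m}" "even l" "i \<in> {s l..u l}"
    "l' \<in> {1..m}" "i + 1 = s l' \<or> i = u l' + 1"
proof -
  obtain j where j: "j \<in> {1..m}" "odd j" "i + 1 = s j \<or> i = u j + 1" and i: "i \<in> {1..n}"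
    using assms by (auto simp: odd_boundary_def)
  from j(3) show thesis
  proof
    assume left: "i + 1 = s j"
    have "j \<noteq> 1" using first_block[of j] j left i by auto
    then have "1 \<le> j - 1" "j - 1 < m" "j - 1 + 1 = j" using j by auto
    then have "s j - 1 \<in> {s (j - 1)..u (j - 1)}" using left_boundary_mem[of "j - 1"] by simp
    moreover have "s j - 1 = i" using left by simp
    ultimately show thesis
      using \<open>j \<noteq> 1\<close> j left by (intro that[of "j - 1" j]) auto
  next
    assume right: "i = u j + 1"
    have "j \<noteq> m" using last_block[of j] j right i by auto
    then show thesis
      using right_boundary_mem[of j] j right by (intro that[of "j + 1" j]) auto
  qed
qed

lemma odd_sweep_le:
  assumes c: "0 \<le> c" and v: "\<And>j. j \<in> odd_boundary \<Longrightarrow> v j \<le> c"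
    and l: "l \<in> {1..m}" "odd l" "i \<in> {s l..u l}"
  shows "odd_sweep v i \<le> 2 * c"
    and "l' \<in> {1..m} \<Longrightarrow> i + 1 = s l' \<or> i = u l' + 1 \<Longrightarrow> odd_sweep v i \<le> lam * c"
  using l c v[OF left_mem_odd_boundary[OF l(1,2)]] v[OF right_mem_odd_boundary[OF l(1,2)]]
  by (auto simp only: odd_sweep_eq[OF l] intro!: update_le_twice update_le_contraction)

text \<open>
  The boundary points of an even block lie in odd blocks, and the odd sweep has already contracted
  the values there.
\<close>
lemma odd_sweep_even_boundary_le:
  assumes c: "0 \<le> c" and v: "\<And>j. j \<in> odd_boundary \<Longrightarrow> v j \<le> c"
    and l: "l \<in> {1..m}" "even l"
  shows "l \<noteq> 1 \<Longrightarrow> odd_sweep v (s l - 1) \<le> lam * c"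
    and "l \<noteq> m \<Longrightarrow> odd_sweep v (u l + 1) \<le> lam * c"
proof -
  assume "l \<noteq> 1"
  then have "1 \<le> l - 1" "l - 1 < m" "odd (l - 1)" "l - 1 + 1 = l" using l by auto
  then show "odd_sweep v (s l - 1) \<le> lam * c"
    using left_boundary_mem[of "l - 1"] l block[of l]
    by (intro odd_sweep_le(2)[OF c v, where l="l - 1" and l'=l]) auto
next
  assume "l \<noteq> m"
  then show "odd_sweep v (u l + 1) \<le> lam * c"
    using right_boundary_mem[of l] l
    by (intro odd_sweep_le(2)[OF c v, where l="l + 1" and l'=l]) auto
qed

text \<open>
  A point of an even block combines two contracted boundary values. A point in no even block keeps the
  value left by the odd sweep, which combines two values bounded by \<open>c\<close> with weights up to \<open>1\<close>.
  This is where the constant \<open>2\<close> comes from.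
\<close>
lemma parallel_sweep_le:
  assumes c: "0 \<le> c" and v: "\<And>j. j \<in> odd_boundary \<Longrightarrow> v j \<le> c" and i: "i \<in> {1..n}"
  shows "even_sweep (odd_sweep v) i \<le> 2 * c"
proof (cases "\<exists>l\<in>{1..m}. even l \<and> i \<in> {s l..u l}")
  case True
  then obtain l where l: "l \<in> {1..m}" "even l" "i \<in> {s l..u l}" by blast
  have lc: "0 \<le> lam * c" "lam * c \<le> c" using lam c by (auto intro: mult_left_le_one_le)
  have "update l (odd_sweep v) i \<le> 2 * (lam * c)"
    using odd_sweep_even_boundary_le[OF c v l(1,2)] l lc by (intro update_le_twice) auto
  then show ?thesis using lc by (simp add: even_sweep_eq[OF l])
next
  case False
  obtain l where l: "l \<in> {1..m}" "i \<in> {s l..u l}" using cover[OF i] by blast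
  with False have "odd l" by blast
  have "even_sweep (odd_sweep v) i = odd_sweep v i"
    by (rule even_sweep_outside) (use False in blast)
  then show ?thesis using odd_sweep_le(1)[OF c v l(1) \<open>odd l\<close> l(2)] by simp
qed

text \<open>
  A boundary point of an odd block is contracted twice: its even block contracts by
  \<open>lam\<close>, and so did the odd blocks that produced the two values read there.
\<close>
lemma parallel_sweep_boundary_le:
  assumes c: "0 \<le> c" and v: "\<And>j. j \<in> odd_boundary \<Longrightarrow> v j \<le> c" and i: "i \<in> odd_boundary"
  shows "even_sweep (odd_sweep v) i \<le> lam\<^sup>2 * c"
proof -
  obtain l l' where l: "l \<in> {1..m}" "even l" "i \<in> {s l..u l}"
    and l': "l' \<in> {1..m}" "i + 1 = s l' \<or> i = u l' + 1"
    using odd_boundary_mem_even_block[OF i] .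
  have "update l (odd_sweep v) i \<le> lam * (lam * c)"
    using odd_sweep_even_boundary_le[OF c v l(1,2)] l l' lam c
    by (intro update_le_contraction[of _ _ _ _ l']) auto
  then show ?thesis by (simp add: even_sweep_eq[OF l] power2_eq_square)
qed

subsection \<open>The left-to-right sweep\<close>

definition right_boundaries :: "nat set" where
  "right_boundaries = {u l + 1 | l. l \<in> {1..<m}}"

text \<open>
  The state after the update of blocks \<open>1, \<dots>, l\<close>. The next block reads on its left the value
  at \<open>s (l + 1) - 1\<close>, which lies in block \<open>l\<close> and is a boundary point, hence bounded by
  \<open>lam * c\<close>; on its right it reads the original value of \<open>v\<close>, since no earlier block reaches that
  far, hence a value bounded by \<open>c\<close>. The combination is at most \<open>(1 + lam) * c\<close> at every point of the
  block, and at most \<open>beta * c\<close> at the right boundary point of the preceding block. The second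
  conjunct is what carries the induction; the other two are the conclusions.
\<close>
lemma left_to_right_sweep_invariant:
  assumes c: "0 \<le> c" and v: "\<And>j. j \<in> right_boundaries \<Longrightarrow> v j \<le> c"
    and beta: "\<And>l. l \<in> {2..m} \<Longrightarrow> lam * a l (u (l - 1) + 1) + b l (u (l - 1) + 1) \<le> beta"
    and l: "l \<le> m"
  shows "(\<forall>j\<in>{1..l}. \<forall>i\<in>{s j..u j}. fold update [1..<l + 1] v i \<le> (1 + lam) * c) \<and>
    (l \<in> {1..<m} \<longrightarrow> fold update [1..<l + 1] v (s (l + 1) - 1) \<le> lam * c) \<and>
    (\<forall>j\<in>{2..l}. fold update [1..<l + 1] v (u (j - 1) + 1) \<le> beta * c)"
  using l
proof (induction l)
  case 0
  then show ?case by simp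
next
  case (Suc l)
  define w where "w = fold update [1..<l + 1] v"
  have fold_eq: "fold update [1..<Suc l + 1] v = update (Suc l) w"
    by (simp add: w_def)
  have IH1: "w i \<le> (1 + lam) * c" if "j \<in> {1..l}" "i \<in> {s j..u j}" for i j
    using Suc that by (simp add: w_def)
  have IH2: "w (s (Suc l) - 1) \<le> lam * c" if "l \<noteq> 0"
    using Suc that by (simp add: w_def)
  have IH3: "w (u (j - 1) + 1) \<le> beta * c" if "j \<in> {2..l}" for j
    using Suc that by (simp add: w_def)
  have L: "Suc l \<in> {1..m}" using Suc.prems by simp
  have right: "w (u (Suc l) + 1) \<le> c" if "Suc l \<noteq> m"
  proof -
    have "w (u (Suc l) + 1) = v (u (Suc l) + 1)"
      unfolding w_def
    proof (rule sweep_outside)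
      fix j assume "j \<in> set [1..<l + 1]"
      then show "u (Suc l) + 1 \<notin> {s j..u j}" using ordered[of j "Suc l"] L by auto
    qed
    also have "\<dots> \<le> c" using that L by (intro v) (auto simp: right_boundaries_def)
    finally show ?thesis .
  qed
  have new: "update (Suc l) w i \<le> a (Suc l) i * (lam * c) + b (Suc l) i * c"
    if "i \<in> {s (Suc l)..u (Suc l)}" for i
    using L that IH2 right by (intro update_le) auto
  have keep: "update (Suc l) w i = w i" if "i \<notin> {s (Suc l)..u (Suc l)}" for i
    using that unfolding update_def by (rule if_not_P)
  have lc: "0 \<le> lam * c" "lam * c \<le> c" using lam c by (auto intro: mult_left_le_one_le)
  have "update (Suc l) w i \<le> (1 + lam) * c" if j: "j \<in> {1..Suc l}" "i \<in> {s j..u j}" for i j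
  proof (cases "i \<in> {s (Suc l)..u (Suc l)}")
    case True
    have "update (Suc l) w i \<le> 1 * (lam * c) + 1 * c"
      using new[OF True] a_range[OF L True] b_range[OF L True] lc c
      by (elim order.trans, intro add_mono mult_right_mono) auto
    then show ?thesis by (simp add: distrib_right)
  next
    case False
    then have "j \<noteq> Suc l" using j by blast
    then have "j \<in> {1..l}" using j by auto
    then show ?thesis using IH1[OF _ j(2)] keep[OF False] by simp
  qed
  moreover have "update (Suc l) w (s (Suc l + 1) - 1) \<le> lam * c" if "Suc l \<in> {1..<m}"
  proof (rule update_le_contraction[where l'="Suc l + 1"])
    show "s (Suc l + 1) - 1 \<in> {s (Suc l)..u (Suc l)}" using left_boundary_mem[of "Suc l"] that by simp
    show "s (Suc l + 1) - 1 + 1 = s (Suc l + 1) \<or> s (Suc l + 1) - 1 = u (Suc l + 1) + 1"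
      using block[of "Suc l + 1"] that by auto
  qed (use L IH2 right lc c that in auto)
  moreover have "update (Suc l) w (u (j - 1) + 1) \<le> beta * c" if j: "j \<in> {2..Suc l}" for j
  proof (cases "j = Suc l")
    case True
    then have "1 \<le> l" using j by simp
    then have "update (Suc l) w (u l + 1) \<le> a (Suc l) (u l + 1) * (lam * c) + b (Suc l) (u l + 1) * c"
      using right_boundary_mem[of l] L by (intro new) auto
    also have "\<dots> = (lam * a (Suc l) (u l + 1) + b (Suc l) (u l + 1)) * c"
      by (simp add: algebra_simps)
    also have "\<dots> \<le> beta * c"
      using beta[of "Suc l"] \<open>1 \<le> l\<close> L c by (intro mult_right_mono) auto
    finally show ?thesis using True by simp
  next
    case False
    then have "j \<in> {2..l}" using j by auto
    moreover from this have "1 \<le> j - 1" "j - 1 + 2 \<le> Suc l" by auto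
    then have "u (j - 1) + 1 \<notin> {s (Suc l)..u (Suc l)}"
      using separated[of "j - 1" "Suc l"] L by auto
    ultimately show ?thesis using IH3 keep by simp
  qed
  ultimately show ?case unfolding fold_eq by blast
qed

lemma left_to_right_sweep_le:
  assumes c: "0 \<le> c" and v: "\<And>j. j \<in> right_boundaries \<Longrightarrow> v j \<le> c" and i: "i \<in> {1..n}"
  shows "fold update [1..<m + 1] v i \<le> (1 + lam) * c"
proof -
  \<comment> \<open>The first part of the invariant does not involve the rate, so any upper bound will do.\<close>
  let ?rates = "(\<lambda>l. lam * a l (u (l - 1) + 1) + b l (u (l - 1) + 1)) ` {2..m}"
  obtain l where "l \<in> {1..m}" "i \<in> {s l..u l}" using cover[OF i] by blast
  then show ?thesis
    using left_to_right_sweep_invariant[OF c v, where beta="Max ?rates" and l=m] by auto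
qed

lemma left_to_right_sweep_boundary_le:
  assumes c: "0 \<le> c" and v: "\<And>j. j \<in> right_boundaries \<Longrightarrow> v j \<le> c"
    and beta: "\<And>l. l \<in> {2..m} \<Longrightarrow> lam * a l (u (l - 1) + 1) + b l (u (l - 1) + 1) \<le> beta"
    and i: "i \<in> right_boundaries"
  shows "fold update [1..<m + 1] v i \<le> beta * c"
proof -
  obtain l where l: "l \<in> {1..<m}" "i = u l + 1"
    using i by (auto simp: right_boundaries_def)
  have "\<forall>j\<in>{2..m}. fold update [1..<m + 1] v (u (j - 1) + 1) \<le> beta * c"
    using left_to_right_sweep_invariant[where v=v and l=m and beta=beta, OF c v beta] by blast
  moreover have "l + 1 \<in> {2..m}" using l by auto
  ultimately have "fold update [1..<m + 1] v (u (l + 1 - 1) + 1) \<le> beta * c" by blast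
  then show ?thesis using l by (simp del: upt_Suc)
qed

end

section \<open>Norms of the matrices of the two samplers\<close>

lemma boundary_interval:
  assumes "1 \<le> s" "s \<le> u" "u \<le> n"
  shows "boundary n {s..u} = {i \<in> {1..n}. i + 1 = s \<or> i = u + 1}"
  using assms by (auto simp: boundary_def)

lemma max0_nonneg: "finite S \<Longrightarrow> (\<And>x. x \<in> S \<Longrightarrow> 0 \<le> x) \<Longrightarrow> 0 \<le> max0 S"
  using Max_in[of S] by (auto simp: max0_def)

lemma le_max0: "finite S \<Longrightarrow> x \<in> S \<Longrightarrow> x \<le> max0 S"
  by (auto simp: max0_def)

lemma sum_two_points:
  fixes s u :: nat and f :: "nat \<Rightarrow> real"
  assumes su: "1 \<le> s" "s \<le> u" and f: "\<And>i. i \<notin> {1..n} \<Longrightarrow> f i = 0"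
  shows "(\<Sum>j\<in>{i \<in> {1..n}. i + 1 = s \<or> i = u + 1}. f j) = f (s - 1) + f (u + 1)"
proof -
  have "(\<Sum>j\<in>{i \<in> {1..n}. i + 1 = s \<or> i = u + 1}. f j) = (\<Sum>j\<in>{s - 1, u + 1}. f j)"
    by (rule sum.mono_neutral_left) (use su f in auto)
  then show ?thesis using su by simp
qed

text \<open>
  By the shape of a block matrix, a row inside the block has nonzero entries only at the boundary
  points. A missing boundary point is \<open>0\<close> or \<open>n + 1\<close>, where \<^const>\<open>entry\<close> is \<open>0\<close>.
\<close>
lemma act_block_matrix:
  assumes W: "W \<in> carrier_mat n n" and J: "1 \<le> s" "s \<le> u" "u \<le> n"
    and outside: "\<And>i j. i \<in> {1..n} - {s..u} \<Longrightarrow> j \<in> {1..n} \<Longrightarrow> entry W i j = (if i = j then 1 else 0)"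
    and inside: "\<And>i j. i \<in> {s..u} \<Longrightarrow> j \<in> {1..n} - boundary n {s..u} \<Longrightarrow> entry W i j = 0"
    and i: "i \<in> {1..n}"
  shows "act W v i = (if i \<in> {s..u} then entry W i (s - 1) * v (s - 1) + entry W i (u + 1) * v (u + 1)
                      else v i)"
proof (cases "i \<in> {s..u}")
  case True
  have "act W v i = (\<Sum>j\<in>boundary n {s..u}. entry W i j * v j)"
    unfolding act_def
    by (rule sum.mono_neutral_right) (use W inside[OF True] in \<open>auto simp: boundary_def\<close>)
  also have "\<dots> = entry W i (s - 1) * v (s - 1) + entry W i (u + 1) * v (u + 1)"
    unfolding boundary_interval[OF J]
    by (rule sum_two_points[OF J(1,2)]) (use W in \<open>auto simp: entry_def\<close>)
  finally show ?thesis using True by simp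
next
  case False
  then have "act W v i = (\<Sum>j\<in>{1..n}. if j = i then v i else 0)"
    unfolding act_def using W outside i by (intro sum.cong) auto
  then have "act W v i = v i" using i by simp
  then show ?thesis unfolding if_not_P[OF False] .
qed

lemma nonneg_mat_mat_prod:
  assumes "set As \<subseteq> carrier_mat n n" "\<And>A. A \<in> set As \<Longrightarrow> nonneg_mat A"
  shows "nonneg_mat (mat_prod n As)"
  using assms
proof (induction As)
  case Nil
  then show ?case by (simp add: mat_prod_def nonneg_mat_one)
next
  case (Cons A As)
  then have "nonneg_mat (A * mat_prod n As)"
    by (intro nonneg_mat_mult[of _ n] mat_prod_carrier) auto
  then show ?case by (simp add: mat_prod_def)
qed

lemma update_matrix_carrier:
  "(\<And>l. l \<in> set ls \<Longrightarrow> W (J l) \<in> carrier_mat n n) \<Longrightarrow> update_matrix n J W ls \<in> carrier_mat n n"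
  unfolding update_matrix_def by (rule mat_prod_carrier) auto

lemma nonneg_update_matrix:
  assumes "\<And>l. l \<in> set ls \<Longrightarrow> W (J l) \<in> carrier_mat n n"
    and "\<And>l. l \<in> set ls \<Longrightarrow> nonneg_mat (W (J l))"
  shows "nonneg_mat (update_matrix n J W ls)"
  unfolding update_matrix_def by (rule nonneg_mat_mat_prod) (use assms in auto)

text \<open>
  The matrices are multiplied in the order opposite to the kernels, so the matrix of the block that
  comes first in \<open>ls\<close> acts first. This is the order of \<^const>\<open>fold\<close>.
\<close>
lemma act_update_matrix:
  assumes carrier: "\<And>l. l \<in> set ls \<Longrightarrow> W (J l) \<in> carrier_mat n n"
    and act: "\<And>l v i. l \<in> set ls \<Longrightarrow> i \<in> {1..n} \<Longrightarrow> act (W (J l)) v i = upd l v i"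
    and i: "i \<in> {1..n}"
  shows "act (update_matrix n J W ls) v i = fold upd ls v i"
  using assms
proof (induction ls arbitrary: i rule: rev_induct)
  case Nil
  then show ?case by (simp add: update_matrix_def mat_prod_def act_one)
next
  case (snoc l ls)
  have eq: "update_matrix n J W (ls @ [l]) = W (J l) * update_matrix n J W ls"
    by (simp add: update_matrix_def mat_prod_def)
  have "update_matrix n J W ls \<in> carrier_mat n n"
    using snoc.prems(1) by (intro update_matrix_carrier) auto
  then have "act (update_matrix n J W (ls @ [l])) v i = act (W (J l)) (act (update_matrix n J W ls) v) i"
    unfolding eq using snoc.prems by (intro act_mult) auto
  also have "\<dots> = act (W (J l)) (fold upd ls v) i"
  proof (rule act_cong)
    show "W (J l) \<in> carrier_mat n n" by (rule snoc.prems(1)) simp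
    show "act (update_matrix n J W ls) v j = fold upd ls v j" if "j \<in> {1..n}" for j
      by (rule snoc.IH[OF _ _ that]) (rule snoc.prems(1,2); simp)+
  qed
  also have "\<dots> = upd l (fold upd ls v) i" by (rule snoc.prems(2)) (simp, rule snoc.prems(3))
  also have "\<dots> = fold upd (ls @ [l]) v i" by simp
  finally show ?case .
qed

theorem theorem6:
  fixes M :: "'a measure" and N :: "'b measure"
    and \<mu>0 :: "'a \<Rightarrow> real" and p :: "'a \<Rightarrow> 'a \<Rightarrow> real" and g :: "'a \<Rightarrow> 'b \<Rightarrow> real"
    and y :: "nat \<Rightarrow> 'b" and n m k :: nat and lam :: real
    and J :: "nat \<Rightarrow> nat set"
    and K :: "nat set \<Rightarrow> (nat \<Rightarrow> 'a) \<Rightarrow> (nat \<Rightarrow> 'a) measure"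
    and W :: "nat set \<Rightarrow> real mat"
  assumes n: "1 \<le> n"
    and hmm: "hidden_markov_model M N \<mu>0 p g"
    and obs: "\<forall>t\<in>{1..n}. y t \<in> space N"
    and const: "0 < smoothing_const M \<mu>0 p g y n" "smoothing_const M \<mu>0 p g y n < \<infinity>"
    and cover: "(\<Union>l\<in>{1..m}. J l) = {1..n}"
    and interval: "\<forall>l\<in>{1..m}. \<exists>s u. 1 \<le> s \<and> s \<le> u \<and> u \<le> n \<and> J l = {s..u}"
    and ordered: "\<forall>j l. 1 \<le> j \<and> j < l \<and> l \<le> m \<longrightarrow>
                    Min (J j) < Min (J l) \<and> Max (J j) < Max (J l)"
    and separated: "\<forall>j l. 1 \<le> j \<and> j + 2 \<le> l \<and> l \<le> m \<longrightarrow> Max (J j) < Min (J l) - 1"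
    and conditional: "\<forall>l\<in>{1..m}. block_conditional M n
                        (smoothing_distribution M \<mu>0 p g y n) (J l) (K (J l))"
    and wasserstein: "\<forall>l\<in>{1..m}. wasserstein_matrix M n
                        (gibbs_kernel M n (J l) (K (J l))) (W (J l))"
    and W_outside: "\<forall>l\<in>{1..m}. \<forall>i\<in>{1..n} - J l. \<forall>j\<in>{1..n}.
                      entry (W (J l)) i j = (if i = j then 1 else 0)"
    and W_inside: "\<forall>l\<in>{1..m}. \<forall>i\<in>J l. \<forall>j\<in>{1..n} - boundary n (J l).
                     entry (W (J l)) i j = 0"
    and W_boundary: "\<forall>l\<in>{1..m}. \<forall>i\<in>J l. \<forall>j\<in>boundary n (J l).
                       entry (W (J l)) i j \<in> {0..1}"
    and lam_less: "lam < 1"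
    and contraction: "\<forall>l\<in>{1..m}.
          max0 ((\<lambda>i. \<Sum>j\<in>boundary n (J l). entry (W (J l)) i j) `
                  (J l \<inter> (\<Union>l'\<in>{1..m}. boundary n (J l')))) \<le> lam"
    and k: "1 \<le> k"
  shows "(wasserstein_matrix M n (par_kernel M n m J K) (par_matrix n m J W) \<and>
          mat_norm_inf (par_matrix n m J W ^\<^sub>m k)
            \<le> mat_norm_inf (par_matrix n m J W) * lam ^ (2 * (k - 1)) \<and>
          mat_norm_inf (par_matrix n m J W) \<le> 2) \<and>
         (wasserstein_matrix M n (left_to_right_kernel M n m J K) (left_to_right_matrix n m J W) \<and>
          mat_norm_inf (left_to_right_matrix n m J W ^\<^sub>m k)
            \<le> mat_norm_inf (left_to_right_matrix n m J W)
                * left_to_right_rate m J W lam ^ (k - 1) \<and>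
          mat_norm_inf (left_to_right_matrix n m J W) \<le> 1 + lam)"
proof -
  define s where "s l = Min (J l)" for l
  define u where "u l = Max (J l)" for l
  \<comment> \<open>If \<open>s l = 1\<close> or \<open>u l = n\<close>, the column index is \<open>0\<close> or \<open>n + 1\<close> and the weight is \<open>0\<close>.\<close>
  define a where "a l i = entry (W (J l)) i (s l - 1)" for l i
  define b where "b l i = entry (W (J l)) i (u l + 1)" for l i
  have J: "1 \<le> s l" "s l \<le> u l" "u l \<le> n" "J l = {s l..u l}" if "l \<in> {1..m}" for l
  proof -
    obtain s' u' where su: "1 \<le> s'" "s' \<le> u'" "u' \<le> n" "J l = {s'..u'}"
      using bspec[OF interval \<open>l \<in> {1..m}\<close>] by (elim exE conjE)
    have "s l = s'" "u l = u'" unfolding s_def u_def su(4) using su(2) by (simp_all add: Min_eq_iff Max_eq_iff)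
    with su show "1 \<le> s l" "s l \<le> u l" "u l \<le> n" "J l = {s l..u l}" by simp_all
  qed
  have bd: "boundary n (J l) = {i \<in> {1..n}. i + 1 = s l \<or> i = u l + 1}" if "l \<in> {1..m}" for l
    using boundary_interval[of "s l" "u l" n] J[OF that] by simp
  have carrier: "W (J l) \<in> carrier_mat n n" and nonneg: "nonneg_mat (W (J l))" if "l \<in> {1..m}" for l
  proof -
    have "wasserstein_matrix M n (gibbs_kernel M n (J l) (K (J l))) (W (J l))"
      using wasserstein that by blast
    then have W: "W (J l) \<in> carrier_mat n n" "\<forall>i\<in>{1..n}. \<forall>j\<in>{1..n}. 0 \<le> entry (W (J l)) i j"
      unfolding wasserstein_matrix_def by blast+
    show "W (J l) \<in> carrier_mat n n" by fact
    have "0 \<le> entry (W (J l)) i j" for i j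
      using W by (cases "i \<in> {1..n} \<and> j \<in> {1..n}") (blast, auto simp: entry_def)
    then show "nonneg_mat (W (J l))" by (simp add: nonneg_mat_def)
  qed
  have entry_zero: "entry (W (J l)) i j = 0" if "l \<in> {1..m}" "j \<notin> {1..n}" for l i j
    using carrier[OF that(1)] that(2) by (auto simp: entry_def)
  have boundary_sum: "(\<Sum>j\<in>boundary n (J l). entry (W (J l)) i j) = a l i + b l i"
    if l: "l \<in> {1..m}" for l i
    unfolding bd[OF l] a_def b_def
    by (rule sum_two_points) (use J[OF l] entry_zero[OF l] in auto)
  have row_le: "a l i + b l i \<le> lam"
    if l: "l \<in> {1..m}" "i \<in> {s l..u l}" "l' \<in> {1..m}" "i + 1 = s l' \<or> i = u l' + 1" for l l' i
  proof -
    have "i \<in> boundary n (J l')" using bd[OF l(3)] J[OF l(1)] l by auto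
    then have "i \<in> J l \<inter> (\<Union>l'\<in>{1..m}. boundary n (J l'))" using J(4)[OF l(1)] l by auto
    then have "a l i + b l i
        \<le> max0 ((\<lambda>i. \<Sum>j\<in>boundary n (J l). entry (W (J l)) i j) `
                  (J l \<inter> (\<Union>l'\<in>{1..m}. boundary n (J l'))))"
      unfolding boundary_sum[OF l(1)] using J(4)[OF l(1)] by (intro le_max0) auto
    also have "\<dots> \<le> lam" using contraction l(1) by blast
    finally show ?thesis .
  qed
  \<comment> \<open>There is at least one block, and \<open>max0\<close> of nonnegative numbers is nonnegative, even for the empty set.\<close>
  have lam_nonneg: "0 \<le> lam"
  proof -
    have "1 \<in> (\<Union>l\<in>{1..m}. J l)" using cover n by simp
    then obtain l where l: "l \<in> {1..m}" by blast
    have "0 \<le> max0 ((\<lambda>i. \<Sum>j\<in>boundary n (J l). entry (W (J l)) i j) `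
                  (J l \<inter> (\<Union>l'\<in>{1..m}. boundary n (J l'))))"
      using J(4)[OF l] nonneg[OF l]
      by (intro max0_nonneg) (auto simp: nonneg_mat_def intro!: sum_nonneg)
    also have "\<dots> \<le> lam" using contraction l by blast
    finally show ?thesis .
  qed
  interpret chain: block_chain n m s u a b lam
  proof
    show "1 \<le> s l \<and> s l \<le> u l \<and> u l \<le> n" if "l \<in> {1..m}" for l using J[OF that] by simp
    show "s j < s l \<and> u j < u l" if "1 \<le> j" "j < l" "l \<le> m" for j l
      using ordered that by (simp add: s_def u_def)
    show "u j + 1 < s l" if "1 \<le> j" "j + 2 \<le> l" "l \<le> m" for j l
    proof -
      have "u j < s l - 1" using separated that by (simp add: s_def u_def)
      then show ?thesis by simp
    qed
    show "\<exists>l\<in>{1..m}. i \<in> {s l..u l}" if "i \<in> {1..n}" for i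
    proof -
      have "i \<in> (\<Union>l\<in>{1..m}. J l)" using cover that by simp
      then obtain l where "l \<in> {1..m}" "i \<in> J l" by blast
      then show ?thesis using J(4)[of l] by blast
    qed
    have range: "entry (W (J l)) i j \<in> {0..1}"
      if l: "l \<in> {1..m}" "i \<in> {s l..u l}" and j: "j + 1 = s l \<or> j = u l + 1 \<or> j = 0" for l i j
    proof (cases "j \<in> {1..n}")
      case True
      then have "j \<in> boundary n (J l)" using bd[OF l(1)] j by auto
      then show ?thesis using W_boundary l J(4)[OF l(1)] by blast
    next
      case False
      then show ?thesis using entry_zero[OF l(1)] by simp
    qed
    show "a l i \<in> {0..1}" if "l \<in> {1..m}" "i \<in> {s l..u l}" for l i
      unfolding a_def using that J(1)[OF that(1)] by (intro range) auto
    show "b l i \<in> {0..1}" if "l \<in> {1..m}" "i \<in> {s l..u l}" for l i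
      unfolding b_def using that by (intro range) auto
    show "a l i = 0" if "l \<in> {1..m}" "s l = 1" for l i
      unfolding a_def using that by (intro entry_zero) auto
    show "b l i = 0" if "l \<in> {1..m}" "u l = n" for l i
      unfolding b_def using that by (intro entry_zero) auto
    show "a l i + b l i \<le> lam"
      if "l \<in> {1..m}" "i \<in> {s l..u l}" "l' \<in> {1..m}" "i + 1 = s l' \<or> i = u l' + 1" for l l' i
      using row_le that .
    show "0 \<le> lam" "lam \<le> 1" using lam_nonneg lam_less by auto
  qed
  \<comment> \<open>From here on, bounds for the matrices are bounds for sweeps along the chain.\<close>
  have act_W: "act (W (J l)) v i = chain.update l v i" if l: "l \<in> {1..m}" and i: "i \<in> {1..n}" for l v i
    unfolding chain.update_def a_def b_def
    by (rule act_block_matrix[OF carrier[OF l] J(1-3)[OF l] _ _ i])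
       (use bspec[OF W_outside l] bspec[OF W_inside l] in \<open>simp_all add: J(4)[OF l, symmetric]\<close>)
  have act_fold: "act (update_matrix n J W ls) v i = fold chain.update ls v i"
    if ls: "set ls \<subseteq> {1..m}" and i: "i \<in> {1..n}" for ls v i
  proof (rule act_update_matrix[OF _ _ i])
    show "W (J l) \<in> carrier_mat n n" if "l \<in> set ls" for l using carrier ls that by blast
    show "act (W (J l)) v i = chain.update l v i" if "l \<in> set ls" "i \<in> {1..n}" for l v i
      using act_W[of l i v] ls that by blast
  qed
  let ?odd = "filter odd [1..<m + 1]" and ?even = "filter even [1..<m + 1]" and ?all = "[1..<m + 1]"
  have sets: "set ?odd \<subseteq> {1..m}" "set ?even \<subseteq> {1..m}" "set ?all \<subseteq> {1..m}" by auto
  have props: "update_matrix n J W ls \<in> carrier_mat n n" "nonneg_mat (update_matrix n J W ls)"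
    if "set ls \<subseteq> {1..m}" for ls
    by (rule update_matrix_carrier nonneg_update_matrix; use that carrier nonneg in blast)+
  have kernels: "update_kernel M n J K ls \<in> measurable (path_space M n) (prob_algebra (path_space M n))
       \<and> wasserstein_matrix M n (update_kernel M n J K ls) (update_matrix n J W ls)"
    if ls: "set ls \<subseteq> {1..m}" for ls
  proof (rule update_kernel_wasserstein)
    fix l assume "l \<in> set ls"
    then have l: "l \<in> {1..m}" using ls by blast
    show "wasserstein_matrix M n (gibbs_kernel M n (J l) (K (J l))) (W (J l))"
      using wasserstein l by blast
    show "gibbs_kernel M n (J l) (K (J l)) \<in> measurable (path_space M n) (prob_algebra (path_space M n))"
    proof (rule measurable_gibbs_kernel)
      show "K (J l) \<in> measurable (PiM ({1..n} - J l) (\<lambda>_. M)) (prob_algebra (PiM (J l) (\<lambda>_. M)))"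
        using bspec[OF conditional l] unfolding block_conditional_def by (rule conjunct1)
      show "J l \<subseteq> {1..n}" using cover l by blast
    qed
  qed
  have par_wasserstein: "wasserstein_matrix M n (par_kernel M n m J K) (par_matrix n m J W)"
    unfolding par_kernel_def[abs_def] par_matrix_def
    by (rule wasserstein_matrix_bind; rule kernels[OF sets(1), THEN conjunct1]
          kernels[OF sets(2), THEN conjunct1] kernels[OF sets(1), THEN conjunct2]
          kernels[OF sets(2), THEN conjunct2])
  have act_par: "act (par_matrix n m J W) v i = chain.even_sweep (chain.odd_sweep v) i"
    if i: "i \<in> {1..n}" for v i
  proof -
    have "act (par_matrix n m J W) v i
        = act (update_matrix n J W ?even) (act (update_matrix n J W ?odd) v) i"
      unfolding par_matrix_def by (rule act_mult[OF props(1)[OF sets(2)] props(1)[OF sets(1)] i])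
    also have "\<dots> = act (update_matrix n J W ?even) (chain.odd_sweep v) i"
      unfolding chain.odd_sweep_def
      by (rule act_cong[OF props(1)[OF sets(2)]]) (rule act_fold[OF sets(1)])
    also have "\<dots> = chain.even_sweep (chain.odd_sweep v) i"
      unfolding chain.even_sweep_def by (rule act_fold[OF sets(2) i])
    finally show ?thesis .
  qed
  have par: "par_matrix n m J W \<in> carrier_mat n n" "nonneg_mat (par_matrix n m J W)"
    unfolding par_matrix_def
    by (rule mult_carrier_mat[OF props(1)[OF sets(2)] props(1)[OF sets(1)]])
       (rule nonneg_mat_mult[OF props(1)[OF sets(2)] props(1)[OF sets(1)]
          props(2)[OF sets(2)] props(2)[OF sets(1)]])
  have par_bound: "act (par_matrix n m J W) v i \<le> 2 * c"
    if "0 \<le> c" "\<And>j. j \<in> chain.odd_boundary \<Longrightarrow> v j \<le> c" "i \<in> {1..n}" for c v i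
    unfolding act_par[OF that(3)] by (rule chain.parallel_sweep_le[OF that])
  have par_bound_boundary: "act (par_matrix n m J W) v i \<le> lam\<^sup>2 * c"
    if "0 \<le> c" "\<And>j. j \<in> chain.odd_boundary \<Longrightarrow> v j \<le> c" "i \<in> {1..n}" "i \<in> chain.odd_boundary"
    for c v i
    unfolding act_par[OF that(3)] by (rule chain.parallel_sweep_boundary_le[OF that(1,2,4)])
  note par_norm = mat_norm_inf_le_of_act_le[OF par n zero_le_power2 k par_bound par_bound_boundary]

  let ?ltr = "left_to_right_matrix n m J W" and ?rate = "left_to_right_rate m J W lam"
  have rate_eq: "?rate = max0 ((\<lambda>l. lam * a l (u (l - 1) + 1) + b l (u (l - 1) + 1)) ` {2..m})"
    by (simp add: left_to_right_rate_def left_boundary_def right_boundary_def a_def b_def s_def u_def)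
  have rate: "lam * a l (u (l - 1) + 1) + b l (u (l - 1) + 1) \<le> ?rate" if "l \<in> {2..m}" for l
    unfolding rate_eq using that by (intro le_max0) auto
  have rate_nonneg: "0 \<le> ?rate"
    unfolding rate_eq
  proof (rule max0_nonneg)
    fix x assume "x \<in> (\<lambda>l. lam * a l (u (l - 1) + 1) + b l (u (l - 1) + 1)) ` {2..m}"
    then obtain l where "l \<in> {2..m}" "x = lam * a l (u (l - 1) + 1) + b l (u (l - 1) + 1)" by blast
    moreover from this have "l \<in> {1..m}" by auto
    ultimately show "0 \<le> x" using nonneg[of l] lam_nonneg by (simp add: a_def b_def nonneg_mat_def)
  qed simp
  have act_ltr: "act ?ltr v i = fold chain.update ?all v i" if "i \<in> {1..n}" for v i
    unfolding left_to_right_matrix_def using act_fold[OF sets(3) that] .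
  have ltr: "?ltr \<in> carrier_mat n n" "nonneg_mat ?ltr"
    unfolding left_to_right_matrix_def using props[OF sets(3)] by blast+
  have ltr_bound: "act ?ltr v i \<le> (1 + lam) * c"
    if "0 \<le> c" "\<And>j. j \<in> chain.right_boundaries \<Longrightarrow> v j \<le> c" "i \<in> {1..n}" for c v i
    unfolding act_ltr[OF that(3)] by (rule chain.left_to_right_sweep_le[OF that])
  have ltr_bound_boundary: "act ?ltr v i \<le> ?rate * c"
    if "0 \<le> c" "\<And>j. j \<in> chain.right_boundaries \<Longrightarrow> v j \<le> c" "i \<in> {1..n}"
      "i \<in> chain.right_boundaries" for c v i
    unfolding act_ltr[OF that(3)]
    by (rule chain.left_to_right_sweep_boundary_le[OF that(1,2) rate that(4)])
  note ltr_norm = mat_norm_inf_le_of_act_le[OF ltr n rate_nonneg k ltr_bound ltr_bound_boundary]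
  have ltr_wasserstein: "wasserstein_matrix M n (left_to_right_kernel M n m J K) ?ltr"
    unfolding left_to_right_kernel_def left_to_right_matrix_def using kernels[OF sets(3)] by blast
  show ?thesis
    using par_wasserstein par_norm ltr_wasserstein ltr_norm unfolding power_mult by blast
qed

end
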